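(* Let $\mathbf z^1$ be a transit network design and $r\in T'$ a trip such that the rider of trip $r$ adopts the transit system under $\mathbf z^1$ and $UB\le\alpha^rt^r_{cur}$, where $UB$ is the upper bound on trip duration defined in the context. Then the consistency cut for $r$ at $\mathbf z^1$ becomes the (valid) inequality $$\sum_{(h,l):z^1_{hl}=1}(1-z_{hl})+\delta^r\ge1.$$
   Context: $N$ is a finite set of nodes, $H\subseteq N$ the set of hubs, $T'$ the set of trips with mode choice. Trip $r$ has distinct origin $or^r$ and destination $de^r$ in $N\setminus H$. For $i,j\in N$, $t_{ij}\ge0$ and $d_{ij}\ge0$ are travel time and distance (possibly asymmetric), each satisfying the triangle inequality. $\theta\in(0,1]$, $g\ge0$ is the shuttle cost per mile, $s\ge0$ the average bus waiting time. Put $\gamma^r_{ij}=(1-\theta)g\,d_{ij}+\theta t_{ij}$ and $\tau^r_{hl}=\theta(t_{hl}+s)$. A design is a $\mathbf z\in\{0,1\}^{|H|\times|H|}$ ($z_{hl}=1$ iff the bus leg from $h$ to $l$ is open); in the design problem it also satisfies weak connectivity $\sum_lz_{hl}=\sum_lz_{lh}$ for all $h\in H$. Given $\mathbf z$, the optimal route of $r$ is a solution of: lexicographically minimize $\langle b^r,f^r\rangle$ (first $b^r$, then $f^r$) over binary $x^r_{hl}$ ($h,l\in H$) and $y^r_{ij}$ ($(i,j)\in A^r$), with $b^r=\sum\tau^r_{hl}x^r_{hl}+\sum\gamma^r_{ij}y^r_{ij}$, $f^r=\sum(t_{hl}+s)x^r_{hl}+\sum t_{ij}y^r_{ij}$,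 subject to $x^r_{hl}\le z_{hl}$ and unit flow conservation from $or^r$ to $de^r$ over bus legs ($x$) and shuttle legs ($y$). Here $A^r=\{(or^r,h),(h,de^r):h\in H\}\cup\{(or^r,de^r)\}$. A route is either a direct shuttle ride from $or^r$ to $de^r$, or a shuttle from $or^r$ to a hub, bus leg(s), and a shuttle from a hub to $de^r$. The trip time is the lexicographically optimal $f^r$ (unique for given $\mathbf z$). With given positive $\alpha^r$, $t^r_{cur}$, the rider of $r$ adopts the system under $\mathbf z$ iff the trip time under $\mathbf z$ is at most $\alpha^rt^r_{cur}$; correspondingly, in the design problem $\delta^r\in\{0,1\}$ is constrained to equal $1$ iff the rider adopts under $\mathbf z$. An inequality in $(\mathbf z,\delta^r)$ is valid if every $(\mathbf z,\delta^r)$ feasible for the design problem satisfies it. Upper bound $UB$ at $\mathbf z^1$, with $t^1$ the trip time under $\mathbf z^1$: if the optimal route under $\mathbf z^1$ uses shuttles from $or^r$ to hub $m$ and from hub $n$ to $de^r$, $UB=t^1+\frac{1-\theta}{\theta}g\big(d_{or^rm}+d_{nde^r}-\min_{h,l\in H}\{d_{or^rh}+d_{lde^r}\}\big)$; if it is a direct shuttle trip, $UB=\max\big\{t^1,\,t^1+\frac{1-\theta}{\theta}g\big(d_{or^rde^r}-\min_{h,l\in H}\{d_{or^rh}+d_{lde^r}\}\big)\big\}$. The basic consistency cut being strengthened is $\sum_{(h,l):z^1_{hl}=0}z_{hl}+\sum_{(h,l):z^1_{hl}=1}(1-z_{hl})+\delta^r\ge1$. *)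

theory Defs imports Complex_Main begin

text \<open>
  An instance of on-demand multimodal transit network design. Nodes have type \<open>'a\<close>, trips have
  type \<open>'r\<close>; \<open>trips\<close> is the set of trips with mode choice. A transit network design is a function
  \<open>z\<close> on pairs of nodes, of which only the values on pairs of hubs are relevant. In the usual notation, \<open>travel\<close> is $t$,
  \<open>distance\<close> is $d$, \<open>weight\<close> is $\theta$, \<open>mile_cost\<close> is $g$, \<open>bus_wait\<close> is $s$,
  \<open>tolerance\<close> is $\alpha$, \<open>cur_time\<close> is $t_{cur}$, \<open>shuttle_weight\<close> is $\gamma$ and
  \<open>bus_weight\<close> is $\tau$; \<open>route_cost\<close> and \<open>route_time\<close> are the objectives $b$ and $f$.
\<close>

record ('a, 'r) transit =
  nodes     :: "'a set"
  hubs      :: "'a set"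
  trips     :: "'r set"
  orig      :: "'r \<Rightarrow> 'a"
  dest      :: "'r \<Rightarrow> 'a"
  travel    :: "'a \<Rightarrow> 'a \<Rightarrow> real"
  distance  :: "'a \<Rightarrow> 'a \<Rightarrow> real"
  weight    :: real
  mile_cost :: real
  bus_wait  :: real
  tolerance :: "'r \<Rightarrow> real"
  cur_time  :: "'r \<Rightarrow> real"

locale transit_instance =
  fixes P :: "('a, 'r) transit"
  assumes finite_nodes: "finite (nodes P)"
    and hubs_subset: "hubs P \<subseteq> nodes P"
    and orig_in: "r \<in> trips P \<Longrightarrow> orig P r \<in> nodes P - hubs P"
    and dest_in: "r \<in> trips P \<Longrightarrow> dest P r \<in> nodes P - hubs P"
    and orig_neq_dest: "r \<in> trips P \<Longrightarrow> orig P r \<noteq> dest P r"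
    and travel_nonneg: "i \<in> nodes P \<Longrightarrow> j \<in> nodes P \<Longrightarrow> 0 \<le> travel P i j"
    and travel_triangle: "i \<in> nodes P \<Longrightarrow> j \<in> nodes P \<Longrightarrow> k \<in> nodes P \<Longrightarrow>
           travel P i k \<le> travel P i j + travel P j k"
    and distance_nonneg: "i \<in> nodes P \<Longrightarrow> j \<in> nodes P \<Longrightarrow> 0 \<le> distance P i j"
    and distance_triangle: "i \<in> nodes P \<Longrightarrow> j \<in> nodes P \<Longrightarrow> k \<in> nodes P \<Longrightarrow>
           distance P i k \<le> distance P i j + distance P j k"
    and weight_pos: "0 < weight P"
    and weight_le_1: "weight P \<le> 1"
    and mile_cost_nonneg: "0 \<le> mile_cost P"
    and bus_wait_nonneg: "0 \<le> bus_wait P"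
    and tolerance_pos: "r \<in> trips P \<Longrightarrow> 0 < tolerance P r"
    and cur_time_pos: "r \<in> trips P \<Longrightarrow> 0 < cur_time P r"

definition shuttle_weight :: "('a, 'r) transit \<Rightarrow> 'a \<Rightarrow> 'a \<Rightarrow> real" where
  "shuttle_weight P i j = (1 - weight P) * mile_cost P * distance P i j + weight P * travel P i j"

definition bus_weight :: "('a, 'r) transit \<Rightarrow> 'a \<Rightarrow> 'a \<Rightarrow> real" where
  "bus_weight P h l = weight P * (travel P h l + bus_wait P)"

definition is_design :: "('a, 'r) transit \<Rightarrow> ('a \<Rightarrow> 'a \<Rightarrow> real) \<Rightarrow> bool" where
  "is_design P z \<longleftrightarrow> (\<forall>h\<in>hubs P. \<forall>l\<in>hubs P. z h l \<in> {0, 1})"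

definition weakly_connected :: "('a, 'r) transit \<Rightarrow> ('a \<Rightarrow> 'a \<Rightarrow> real) \<Rightarrow> bool" where
  "weakly_connected P z \<longleftrightarrow>
     (\<forall>h\<in>hubs P. (\<Sum>l\<in>hubs P. z h l) = (\<Sum>l\<in>hubs P. z l h))"

definition shuttle_arcs :: "('a, 'r) transit \<Rightarrow> 'r \<Rightarrow> ('a \<times> 'a) set" where
  "shuttle_arcs P r =
     {orig P r} \<times> hubs P \<union> hubs P \<times> {dest P r} \<union> {(orig P r, dest P r)}"

definition net_outflow ::
  "('a, 'r) transit \<Rightarrow> 'r \<Rightarrow> ('a \<Rightarrow> 'a \<Rightarrow> real) \<Rightarrow> ('a \<Rightarrow> 'a \<Rightarrow> real) \<Rightarrow> 'a \<Rightarrow> real" where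
  "net_outflow P r x y i =
     (if i \<in> hubs P then (\<Sum>l\<in>hubs P. x i l) - (\<Sum>l\<in>hubs P. x l i) else 0)
     + (\<Sum>j | (i, j) \<in> shuttle_arcs P r. y i j) - (\<Sum>j | (j, i) \<in> shuttle_arcs P r. y j i)"

definition feasible_route ::
  "('a, 'r) transit \<Rightarrow> ('a \<Rightarrow> 'a \<Rightarrow> real) \<Rightarrow> 'r
    \<Rightarrow> ('a \<Rightarrow> 'a \<Rightarrow> real) \<Rightarrow> ('a \<Rightarrow> 'a \<Rightarrow> real) \<Rightarrow> bool" where
  "feasible_route P z r x y \<longleftrightarrow>
     (\<forall>h\<in>hubs P. \<forall>l\<in>hubs P. x h l \<in> {0, 1} \<and> x h l \<le> z h l) \<and>
     (\<forall>(i, j)\<in>shuttle_arcs P r. y i j \<in> {0, 1}) \<and>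
     (\<forall>i\<in>nodes P. net_outflow P r x y i =
        (if i = orig P r then 1 else if i = dest P r then - 1 else 0))"

definition route_cost ::
  "('a, 'r) transit \<Rightarrow> 'r \<Rightarrow> ('a \<Rightarrow> 'a \<Rightarrow> real) \<Rightarrow> ('a \<Rightarrow> 'a \<Rightarrow> real) \<Rightarrow> real" where
  "route_cost P r x y =
     (\<Sum>(h, l)\<in>hubs P \<times> hubs P. bus_weight P h l * x h l)
     + (\<Sum>(i, j)\<in>shuttle_arcs P r. shuttle_weight P i j * y i j)"

definition route_time ::
  "('a, 'r) transit \<Rightarrow> 'r \<Rightarrow> ('a \<Rightarrow> 'a \<Rightarrow> real) \<Rightarrow> ('a \<Rightarrow> 'a \<Rightarrow> real) \<Rightarrow> real" where
  "route_time P r x y =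
     (\<Sum>(h, l)\<in>hubs P \<times> hubs P. (travel P h l + bus_wait P) * x h l)
     + (\<Sum>(i, j)\<in>shuttle_arcs P r. travel P i j * y i j)"

definition optimal_route ::
  "('a, 'r) transit \<Rightarrow> ('a \<Rightarrow> 'a \<Rightarrow> real) \<Rightarrow> 'r
    \<Rightarrow> ('a \<Rightarrow> 'a \<Rightarrow> real) \<Rightarrow> ('a \<Rightarrow> 'a \<Rightarrow> real) \<Rightarrow> bool" where
  "optimal_route P z r x y \<longleftrightarrow>
     feasible_route P z r x y \<and>
     (\<forall>x' y'. feasible_route P z r x' y' \<longrightarrow>
        route_cost P r x y < route_cost P r x' y' \<or>
        route_cost P r x y = route_cost P r x' y' \<and> route_time P r x y \<le> route_time P r x' y')"

text \<open>
  Optimal routes need not be unique, but all of them have the same travel time.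
\<close>

definition trip_time :: "('a, 'r) transit \<Rightarrow> ('a \<Rightarrow> 'a \<Rightarrow> real) \<Rightarrow> 'r \<Rightarrow> real" where
  "trip_time P z r = (THE f. \<exists>x y. optimal_route P z r x y \<and> f = route_time P r x y)"

definition adopts :: "('a, 'r) transit \<Rightarrow> ('a \<Rightarrow> 'a \<Rightarrow> real) \<Rightarrow> 'r \<Rightarrow> bool" where
  "adopts P z r \<longleftrightarrow> trip_time P z r \<le> tolerance P r * cur_time P r"

definition design_feasible ::
  "('a, 'r) transit \<Rightarrow> ('a \<Rightarrow> 'a \<Rightarrow> real) \<Rightarrow> ('r \<Rightarrow> real) \<Rightarrow> bool" where
  "design_feasible P z \<delta> \<longleftrightarrow>
     is_design P z \<and> weakly_connected P z \<and>
     (\<forall>r\<in>trips P. \<delta> r \<in> {0, 1} \<and> (\<delta> r = 1 \<longleftrightarrow> adopts P z r))"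

definition valid_inequality ::
  "('a, 'r) transit \<Rightarrow> 'r \<Rightarrow> (('a \<Rightarrow> 'a \<Rightarrow> real) \<Rightarrow> real \<Rightarrow> bool) \<Rightarrow> bool" where
  "valid_inequality P r ineq \<longleftrightarrow> (\<forall>z \<delta>. design_feasible P z \<delta> \<longrightarrow> ineq z (\<delta> r))"

definition min_shuttle_distance :: "('a, 'r) transit \<Rightarrow> 'r \<Rightarrow> real" where
  "min_shuttle_distance P r =
     (MIN (h, l)\<in>hubs P \<times> hubs P. distance P (orig P r) h + distance P l (dest P r))"

text \<open>
  The upper bound on the trip time depends on the optimal route chosen under \<open>z\<close>, through its
  shuttle legs \<open>y\<close>. If there are no hubs, \<open>min_shuttle_distance\<close> is an unspecified number. By flow conservation, a route that is not a direct shuttle ride uses exactly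
  one shuttle leg from the origin to a hub and exactly one from a hub to the destination.
\<close>

definition first_hub :: "('a, 'r) transit \<Rightarrow> 'r \<Rightarrow> ('a \<Rightarrow> 'a \<Rightarrow> real) \<Rightarrow> 'a" where
  "first_hub P r y = (THE m. m \<in> hubs P \<and> y (orig P r) m = 1)"

definition last_hub :: "('a, 'r) transit \<Rightarrow> 'r \<Rightarrow> ('a \<Rightarrow> 'a \<Rightarrow> real) \<Rightarrow> 'a" where
  "last_hub P r y = (THE n. n \<in> hubs P \<and> y n (dest P r) = 1)"

definition trip_time_bound ::
  "('a, 'r) transit \<Rightarrow> ('a \<Rightarrow> 'a \<Rightarrow> real) \<Rightarrow> 'r \<Rightarrow> ('a \<Rightarrow> 'a \<Rightarrow> real) \<Rightarrow> real" where
  "trip_time_bound P z r y =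
     (if y (orig P r) (dest P r) = 1
      then max (trip_time P z r)
             (trip_time P z r + (1 - weight P) / weight P * mile_cost P *
                (distance P (orig P r) (dest P r) - min_shuttle_distance P r))
      else trip_time P z r + (1 - weight P) / weight P * mile_cost P *
             (distance P (orig P r) (first_hub P r y) + distance P (last_hub P r y) (dest P r)
              - min_shuttle_distance P r))"

end

theory Submission imports Defs begin

text \<open>
  The cost of a route is \<open>\<theta> f + (1 - \<theta>) g D\<close>, where \<open>f\<close> is its time and \<open>D\<close> its total shuttle
  distance. If no leg of \<open>z\<^sup>1\<close> is closed in \<open>z\<close>, the old optimal route stays feasible, so the new
  optimal route is at most as costly and its time is at most \<open>f\<^sup>1 + (1 - \<theta>)/\<theta> g (D\<^sup>1 - D)\<close>.
  A new route through hubs has \<open>D\<close> at least the minimal shuttle distance. A new route that is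
  direct was already available under \<open>z\<^sup>1\<close>, so the trip time has not changed.
\<close>

section \<open>Binary sums and lexicographic minima\<close>

text \<open>Singles out the one leg that carries a unit of flow: a nonzero term already exhausts the
  sum, so the remaining nonnegative terms vanish.\<close>

lemma binary_sum_eq_1:
  fixes f :: "'b \<Rightarrow> real"
  assumes "finite A" and bin: "\<And>a. a \<in> A \<Longrightarrow> f a \<in> {0, 1}" and sum: "sum f A = 1"
  obtains a where "a \<in> A" "f a = 1" "\<And>b. b \<in> A \<Longrightarrow> b \<noteq> a \<Longrightarrow> f b = 0"
proof -
  obtain a where a: "a \<in> A" "f a \<noteq> 0"
    using sum by (metis sum.neutral zero_neq_one)
  then have fa: "f a = 1" using bin by auto
  then have "sum f (A - {a}) = 0"
    using sum sum.remove[OF \<open>finite A\<close> a(1), of f] by simp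
  moreover have "\<And>b. b \<in> A - {a} \<Longrightarrow> 0 \<le> f b"
    using bin by force
  ultimately have "\<forall>b\<in>A - {a}. f b = 0"
    using \<open>finite A\<close> sum_nonneg_eq_0_iff[of "A - {a}" f] by simp
  then show thesis using that a fa by blast
qed

text \<open>Minimize the first component, then the second over the fibre \<open>W\<close> above that
  minimum; finiteness makes both minima attained.\<close>

lemma lexicographic_minimum_exists:
  fixes V :: "('b :: linorder \<times> 'c :: linorder) set"
  assumes "finite V" "V \<noteq> {}"
  obtains b f where "(b, f) \<in> V" "\<And>b' f'. (b', f') \<in> V \<Longrightarrow> b < b' \<or> b = b' \<and> f \<le> f'"
proof -
  define b where "b = Min (fst ` V)"
  define W where "W = {f. (b, f) \<in> V}"
  have "b \<in> fst ` V"
    unfolding b_def using assms by (intro Min_in) auto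
  then have "W \<noteq> {}" by (auto simp: W_def)
  have "W \<subseteq> snd ` V" by (force simp: W_def)
  then have "finite W" using assms(1) finite_surj by blast
  then have "Min W \<in> W" using \<open>W \<noteq> {}\<close> by simp
  have "b < b' \<or> b = b' \<and> Min W \<le> f'" if "(b', f') \<in> V" for b' f'
  proof -
    have "b \<le> b'"
      unfolding b_def using assms(1) that by (intro Min_le) force+
    moreover have "Min W \<le> f'" if "b = b'"
      using \<open>finite W\<close> \<open>(b', f') \<in> V\<close> that by (intro Min_le) (auto simp: W_def)
    ultimately show ?thesis by force
  qed
  then show thesis using that \<open>Min W \<in> W\<close> by (auto simp: W_def)
qed

section \<open>Trip time and monotonicity in the design\<close>

text \<open>Each of two optimal routes competes against the other, and the lexicographic order is
  antisymmetric. This is the uniqueness behind the definite description in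
  \<open>trip_time\<close>.\<close>

lemma optimal_route_time_unique:
  assumes "optimal_route P z r x y" "optimal_route P z r x' y'"
  shows "route_time P r x y = route_time P r x' y'"
proof -
  have "route_cost P r x y < route_cost P r x' y' \<or>
      route_cost P r x y = route_cost P r x' y' \<and> route_time P r x y \<le> route_time P r x' y'"
    "route_cost P r x' y' < route_cost P r x y \<or>
      route_cost P r x' y' = route_cost P r x y \<and> route_time P r x' y' \<le> route_time P r x y"
    using assms by (simp_all add: optimal_route_def)
  then show ?thesis by linarith
qed

lemma trip_time_eq:
  assumes "optimal_route P z r x y"
  shows "trip_time P z r = route_time P r x y"
  unfolding trip_time_def using assms
  by (auto intro!: the_equality dest: optimal_route_time_unique[OF assms])

text \<open>The design enters only through the bounds \<open>x h l \<le> z h l\<close>, which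
  opening further legs relaxes.\<close>

lemma feasible_route_mono:
  assumes "feasible_route P z r x y"
    and "\<And>h l. h \<in> hubs P \<Longrightarrow> l \<in> hubs P \<Longrightarrow> z h l \<le> z' h l"
  shows "feasible_route P z' r x y"
  using assms unfolding feasible_route_def by (meson order_trans)

section \<open>Cost as weighted time plus shuttle distance\<close>

definition shuttle_distance :: "('a, 'r) transit \<Rightarrow> 'r \<Rightarrow> ('a \<Rightarrow> 'a \<Rightarrow> real) \<Rightarrow> real" where
  "shuttle_distance P r y = (\<Sum>(i, j)\<in>shuttle_arcs P r. distance P i j * y i j)"

text \<open>Bus weights are \<open>weight P\<close> times a duration; only shuttle weights carry an
  additional distance term.\<close>

lemma route_cost_eq:
  "route_cost P r x y =
     weight P * route_time P r x y + (1 - weight P) * mile_cost P * shuttle_distance P r y"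
proof -
  have "(\<Sum>(h, l)\<in>hubs P \<times> hubs P. bus_weight P h l * x h l) =
      weight P * (\<Sum>(h, l)\<in>hubs P \<times> hubs P. (travel P h l + bus_wait P) * x h l)"
    by (simp add: sum_distrib_left bus_weight_def case_prod_unfold mult.assoc)
  moreover have "(\<Sum>(i, j)\<in>shuttle_arcs P r. shuttle_weight P i j * y i j) =
      (1 - weight P) * mile_cost P * shuttle_distance P r y
      + weight P * (\<Sum>(i, j)\<in>shuttle_arcs P r. travel P i j * y i j)"
    unfolding shuttle_distance_def sum_distrib_left sum.distrib[symmetric]
    by (intro sum.cong) (auto simp: shuttle_weight_def algebra_simps)
  ultimately show ?thesis by (simp add: route_cost_def route_time_def algebra_simps)
qed

context transit_instance
begin

section \<open>Shuttle arcs and flow conservation at origin and destination\<close>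

lemma finite_hubs: "finite (hubs P)"
  using finite_nodes hubs_subset by (rule rev_finite_subset)

lemma finite_shuttle_arcs: "finite (shuttle_arcs P r)"
  by (simp add: shuttle_arcs_def finite_hubs)

lemma min_shuttle_distance_le:
  assumes "h \<in> hubs P" "l \<in> hubs P"
  shows "min_shuttle_distance P r \<le> distance P (orig P r) h + distance P l (dest P r)"
  unfolding min_shuttle_distance_def using assms finite_hubs by (intro Min_le) auto

text \<open>The three families of arcs are disjoint because neither end of the trip is a
  hub.\<close>

lemma sum_shuttle_arcs:
  fixes F :: "'a \<times> 'a \<Rightarrow> real"
  assumes "r \<in> trips P"
  shows "sum F (shuttle_arcs P r) =
    (\<Sum>h\<in>hubs P. F (orig P r, h)) + (\<Sum>h\<in>hubs P. F (h, dest P r)) + F (orig P r, dest P r)"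
proof -
  let ?o = "orig P r" and ?d = "dest P r"
  have "?o \<notin> hubs P" "?d \<notin> hubs P"
    using assms orig_in dest_in by auto
  then have "sum F (shuttle_arcs P r) =
      sum F ({?o} \<times> hubs P) + sum F (hubs P \<times> {?d}) + sum F {(?o, ?d)}"
    unfolding shuttle_arcs_def
    by (subst sum.union_disjoint; (subst sum.union_disjoint)?) (auto simp: finite_hubs)
  then show ?thesis
    by (simp add: sum.cartesian_product')
qed

text \<open>The origin is neither a hub nor the destination, so no shuttle arc enters it and the bus
  terms drop out.\<close>

lemma net_outflow_orig:
  assumes "r \<in> trips P"
  shows "net_outflow P r x y (orig P r) =
    (\<Sum>h\<in>hubs P. y (orig P r) h) + y (orig P r) (dest P r)"
proof -
  have "orig P r \<notin> hubs P" "dest P r \<notin> hubs P" "orig P r \<noteq> dest P r"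
    using assms orig_in dest_in orig_neq_dest by auto
  moreover from this have "{j. (orig P r, j) \<in> shuttle_arcs P r} = insert (dest P r) (hubs P)"
    "{j. (j, orig P r) \<in> shuttle_arcs P r} = {}"
    by (auto simp: shuttle_arcs_def)
  ultimately show ?thesis by (simp add: net_outflow_def finite_hubs)
qed

lemma net_outflow_dest:
  assumes "r \<in> trips P"
  shows "net_outflow P r x y (dest P r) =
    - ((\<Sum>h\<in>hubs P. y h (dest P r)) + y (orig P r) (dest P r))"
proof -
  have "orig P r \<notin> hubs P" "dest P r \<notin> hubs P" "orig P r \<noteq> dest P r"
    using assms orig_in dest_in orig_neq_dest by auto
  moreover from this have "{j. (j, dest P r) \<in> shuttle_arcs P r} = insert (orig P r) (hubs P)"
    "{j. (dest P r, j) \<in> shuttle_arcs P r} = {}"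
    by (auto simp: shuttle_arcs_def)
  ultimately show ?thesis by (simp add: net_outflow_def finite_hubs)
qed

lemma feasible_route_shuttle_sums:
  assumes "r \<in> trips P" "feasible_route P z r x y"
  shows "(\<Sum>h\<in>hubs P. y (orig P r) h) + y (orig P r) (dest P r) = 1"
    and "(\<Sum>h\<in>hubs P. y h (dest P r)) + y (orig P r) (dest P r) = 1"
proof -
  have "net_outflow P r x y (orig P r) = 1" "net_outflow P r x y (dest P r) = -1"
    using assms orig_in dest_in orig_neq_dest[of r] unfolding feasible_route_def by auto
  then show "(\<Sum>h\<in>hubs P. y (orig P r) h) + y (orig P r) (dest P r) = 1"
    and "(\<Sum>h\<in>hubs P. y h (dest P r)) + y (orig P r) (dest P r) = 1"
    using net_outflow_orig[OF assms(1)] net_outflow_dest[OF assms(1)] by simp_all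
qed

lemma feasible_route_shuttle_binary:
  assumes "feasible_route P z r x y"
  shows "y (orig P r) (dest P r) \<in> {0, 1}"
    and "h \<in> hubs P \<Longrightarrow> y (orig P r) h \<in> {0, 1}"
    and "h \<in> hubs P \<Longrightarrow> y h (dest P r) \<in> {0, 1}"
  using assms unfolding feasible_route_def shuttle_arcs_def by auto

section \<open>The direct shuttle ride\<close>

definition direct_shuttle :: "'r \<Rightarrow> 'a \<Rightarrow> 'a \<Rightarrow> real" where
  "direct_shuttle r i j = (if i = orig P r \<and> j = dest P r then 1 else 0)"

text \<open>Being available under every design, this route makes the feasible set nonempty and links
  the optima of two different designs.\<close>

lemma feasible_direct_route:
  assumes r: "r \<in> trips P" and z: "is_design P z"
  shows "feasible_route P z r (\<lambda>_ _. 0) (direct_shuttle r)"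
proof -
  have o: "orig P r \<notin> hubs P" and d: "dest P r \<notin> hubs P" and ne: "orig P r \<noteq> dest P r"
    using r orig_in dest_in orig_neq_dest by auto
  have "net_outflow P r (\<lambda>_ _. 0) (direct_shuttle r) i =
      (if i = orig P r then 1 else if i = dest P r then - 1 else 0)" for i
  proof (cases "i = orig P r \<or> i = dest P r")
    case True
    then show ?thesis
      using o d ne net_outflow_orig[OF r] net_outflow_dest[OF r]
      by (auto simp: direct_shuttle_def intro!: sum.neutral)
  next
    case False
    \<comment> \<open>The only leg in use neither starts nor ends at \<open>i\<close>, so every term
      is zero.\<close>
    then show ?thesis by (simp add: net_outflow_def direct_shuttle_def)
  qed
  moreover have "0 \<le> z h l" if "h \<in> hubs P" "l \<in> hubs P" for h l
    using z that unfolding is_design_def by force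
  ultimately show ?thesis
    unfolding feasible_route_def by (auto simp: direct_shuttle_def)
qed

text \<open>The direct leg takes the whole unit of flow, leaving zero for the other nonnegative
  shuttle legs.\<close>

lemma feasible_direct_shuttle_eq:
  assumes r: "r \<in> trips P" and fr: "feasible_route P z r x y"
    and dir: "y (orig P r) (dest P r) = 1" and "(i, j) \<in> shuttle_arcs P r"
  shows "y i j = direct_shuttle r i j"
proof -
  have "(\<Sum>h\<in>hubs P. y (orig P r) h) = 0" "(\<Sum>h\<in>hubs P. y h (dest P r)) = 0"
    using feasible_route_shuttle_sums[OF r fr] dir by simp_all
  moreover have "0 \<le> y (orig P r) h" "0 \<le> y h (dest P r)" if "h \<in> hubs P" for h
    using feasible_route_shuttle_binary[OF fr] that by force+
  ultimately have "y (orig P r) h = 0" "y h (dest P r) = 0" if "h \<in> hubs P" for h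
    using that finite_hubs by (simp_all add: sum_nonneg_eq_0_iff)
  moreover have "orig P r \<notin> hubs P" "dest P r \<notin> hubs P"
    using r orig_in dest_in by auto
  ultimately show ?thesis
    using assms(4) dir by (auto simp: shuttle_arcs_def direct_shuttle_def)
qed

text \<open>A feasible route with a direct shuttle may still contain bus legs, as a circulation
  among the hubs. Removing them saves a nonnegative time and leaves the shuttle distance
  unchanged.\<close>

lemma direct_route_dominates:
  assumes r: "r \<in> trips P" and fr: "feasible_route P z r x y"
    and dir: "y (orig P r) (dest P r) = 1"
  shows "route_time P r (\<lambda>_ _. 0) (direct_shuttle r) \<le> route_time P r x y"
    and "route_cost P r (\<lambda>_ _. 0) (direct_shuttle r) \<le> route_cost P r x y"
proof -
  have x: "0 \<le> x h l" "0 \<le> travel P h l" if "h \<in> hubs P" "l \<in> hubs P" for h l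
  proof -
    have "x h l \<in> {0, 1}" using fr that unfolding feasible_route_def by blast
    then show "0 \<le> x h l" by auto
    show "0 \<le> travel P h l" using that hubs_subset by (intro travel_nonneg) auto
  qed
  have sums: "(\<Sum>(i, j)\<in>shuttle_arcs P r. c i j * y i j) =
      (\<Sum>(i, j)\<in>shuttle_arcs P r. c i j * direct_shuttle r i j)" for c
    by (intro sum.cong) (auto simp: feasible_direct_shuttle_eq[OF r fr dir])
  have "0 \<le> (\<Sum>(h, l)\<in>hubs P \<times> hubs P. (travel P h l + bus_wait P) * x h l)"
    using x bus_wait_nonneg by (intro sum_nonneg) auto
  then show time: "route_time P r (\<lambda>_ _. 0) (direct_shuttle r) \<le> route_time P r x y"
    unfolding route_time_def sums by simp
  have "shuttle_distance P r y = shuttle_distance P r (direct_shuttle r)"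
    unfolding shuttle_distance_def by (rule sums)
  then show "route_cost P r (\<lambda>_ _. 0) (direct_shuttle r) \<le> route_cost P r x y"
    using time weight_pos by (simp add: route_cost_eq)
qed

lemma shuttle_distance_direct:
  assumes r: "r \<in> trips P" and fr: "feasible_route P z r x y"
    and dir: "y (orig P r) (dest P r) = 1"
  shows "shuttle_distance P r y = distance P (orig P r) (dest P r)"
proof -
  have "orig P r \<notin> hubs P" "dest P r \<notin> hubs P"
    using r orig_in dest_in by auto
  moreover have "shuttle_distance P r y =
      (\<Sum>(i, j)\<in>shuttle_arcs P r. distance P i j * direct_shuttle r i j)"
    unfolding shuttle_distance_def
    by (intro sum.cong) (auto simp: feasible_direct_shuttle_eq[OF r fr dir])
  ultimately show ?thesis
    by (simp add: sum_shuttle_arcs[OF r] direct_shuttle_def if_distrib[of "(*) _"] finite_hubs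
        cong: if_cong)
qed

section \<open>Routes through hubs\<close>

text \<open>Without the direct leg, the unit flow leaves the origin on exactly one binary leg and
  reaches the destination on exactly one, which also determines \<open>first_hub\<close> and
  \<open>last_hub\<close>.\<close>

lemma shuttle_distance_via_hubs:
  assumes r: "r \<in> trips P" and fr: "feasible_route P z r x y"
    and ndir: "y (orig P r) (dest P r) \<noteq> 1"
  shows "first_hub P r y \<in> hubs P" and "last_hub P r y \<in> hubs P"
    and "shuttle_distance P r y =
      distance P (orig P r) (first_hub P r y) + distance P (last_hub P r y) (dest P r)"
proof -
  have y0: "y (orig P r) (dest P r) = 0"
    using ndir feasible_route_shuttle_binary(1)[OF fr] by auto
  obtain m where m: "m \<in> hubs P" "y (orig P r) m = 1"
    "\<And>h. h \<in> hubs P \<Longrightarrow> h \<noteq> m \<Longrightarrow> y (orig P r) h = 0"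
    using binary_sum_eq_1[OF finite_hubs, of "y (orig P r)"]
      feasible_route_shuttle_binary(2)[OF fr] feasible_route_shuttle_sums(1)[OF r fr] y0
    by auto
  obtain n where n: "n \<in> hubs P" "y n (dest P r) = 1"
    "\<And>h. h \<in> hubs P \<Longrightarrow> h \<noteq> n \<Longrightarrow> y h (dest P r) = 0"
    using binary_sum_eq_1[OF finite_hubs, of "\<lambda>h. y h (dest P r)"]
      feasible_route_shuttle_binary(3)[OF fr] feasible_route_shuttle_sums(2)[OF r fr] y0
    by auto
  have fm: "first_hub P r y = m"
    unfolding first_hub_def using m by (intro the_equality) force+
  have ln: "last_hub P r y = n"
    unfolding last_hub_def using n by (intro the_equality) force+
  have "(\<Sum>h\<in>hubs P. distance P (orig P r) h * y (orig P r) h) =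
      (\<Sum>h\<in>hubs P. if h = m then distance P (orig P r) h else 0)"
    using m by (intro sum.cong) auto
  moreover have "(\<Sum>h\<in>hubs P. distance P h (dest P r) * y h (dest P r)) =
      (\<Sum>h\<in>hubs P. if h = n then distance P h (dest P r) else 0)"
    using n by (intro sum.cong) auto
  ultimately show "shuttle_distance P r y =
      distance P (orig P r) (first_hub P r y) + distance P (last_hub P r y) (dest P r)"
    using m n y0 finite_hubs by (simp add: shuttle_distance_def sum_shuttle_arcs[OF r] fm ln)
  show "first_hub P r y \<in> hubs P" "last_hub P r y \<in> hubs P"
    using m n fm ln by simp_all
qed

lemma min_shuttle_distance_le_shuttle_distance:
  assumes "r \<in> trips P" "feasible_route P z r x y" "y (orig P r) (dest P r) \<noteq> 1"
  shows "min_shuttle_distance P r \<le> shuttle_distance P r y"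
  using shuttle_distance_via_hubs[OF assms] min_shuttle_distance_le by simp

section \<open>Existence of an optimal route\<close>

text \<open>The functions \<open>x\<close> and \<open>y\<close> are arbitrary off the relevant arcs,
  so finiteness is claimed for values rather than routes: cost and time depend only on the sets
  \<open>A\<close> and \<open>B\<close> of arcs in use.\<close>

lemma finite_feasible_values:
  "finite {(route_cost P r x y, route_time P r x y) | x y. feasible_route P z r x y}"
    (is "finite ?V")
proof -
  define ind :: "('a \<times> 'a) set \<Rightarrow> 'a \<Rightarrow> 'a \<Rightarrow> real"
    where "ind A i j = (if (i, j) \<in> A then 1 else 0)" for A i j
  let ?val = "\<lambda>(A, B). (route_cost P r (ind A) (ind B), route_time P r (ind A) (ind B))"
  have "?V \<subseteq> ?val ` (Pow (hubs P \<times> hubs P) \<times> Pow (shuttle_arcs P r))"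
  proof clarify
    fix x y assume fr: "feasible_route P z r x y"
    define A where "A = {(h, l) \<in> hubs P \<times> hubs P. x h l = 1}"
    define B where "B = {(i, j) \<in> shuttle_arcs P r. y i j = 1}"
    have x: "x h l = ind A h l" if "h \<in> hubs P" "l \<in> hubs P" for h l
      using fr that unfolding feasible_route_def A_def ind_def by auto
    have y: "y i j = ind B i j" if "(i, j) \<in> shuttle_arcs P r" for i j
      using fr that unfolding feasible_route_def B_def ind_def by auto
    have "(\<Sum>(h, l)\<in>hubs P \<times> hubs P. c h l * x h l) =
        (\<Sum>(h, l)\<in>hubs P \<times> hubs P. c h l * ind A h l)" for c
      by (intro sum.cong) (auto simp: x)
    moreover have "(\<Sum>(i, j)\<in>shuttle_arcs P r. c i j * y i j) =
        (\<Sum>(i, j)\<in>shuttle_arcs P r. c i j * ind B i j)" for c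
      by (intro sum.cong) (auto simp: y)
    ultimately have "(route_cost P r x y, route_time P r x y) = ?val (A, B)"
      by (simp add: route_cost_def route_time_def)
    moreover have "(A, B) \<in> Pow (hubs P \<times> hubs P) \<times> Pow (shuttle_arcs P r)"
      by (auto simp: A_def B_def)
    ultimately show "(route_cost P r x y, route_time P r x y)
        \<in> ?val ` (Pow (hubs P \<times> hubs P) \<times> Pow (shuttle_arcs P r))"
      by (rule image_eqI)
  qed
  then show ?thesis
    by (rule finite_subset) (simp add: finite_hubs finite_shuttle_arcs)
qed

lemma optimal_route_exists:
  assumes "r \<in> trips P" "is_design P z"
  obtains x y where "optimal_route P z r x y"
proof -
  let ?V = "{(route_cost P r x y, route_time P r x y) | x y. feasible_route P z r x y}"
  have nonempty: "?V \<noteq> {}" using feasible_direct_route[OF assms] by blast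
  obtain b f where bf: "(b, f) \<in> ?V"
    and min: "\<And>b' f'. (b', f') \<in> ?V \<Longrightarrow> b < b' \<or> b = b' \<and> f \<le> f'"
    by (rule lexicographic_minimum_exists[OF finite_feasible_values nonempty]) (rule that)
  from bf obtain x y where "feasible_route P z r x y"
    "b = route_cost P r x y" "f = route_time P r x y" by blast
  then have "optimal_route P z r x y"
    unfolding optimal_route_def using min by blast
  then show thesis by (rule that)
qed

section \<open>Bounding the trip time when no open leg is closed\<close>

lemma trip_time_le_bound:
  assumes r: "r \<in> trips P" and z1: "is_design P z1" and z: "is_design P z"
    and le: "\<And>h l. h \<in> hubs P \<Longrightarrow> l \<in> hubs P \<Longrightarrow> z1 h l \<le> z h l"
    and opt1: "optimal_route P z1 r x1 y1"
  shows "trip_time P z r \<le> trip_time_bound P z1 r y1"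
proof -
  obtain x y where opt: "optimal_route P z r x y"
    using optimal_route_exists[OF r z] .
  \<comment> \<open>Dividing the cost by \<open>weight P\<close> gives time plus \<open>c\<close>
    times shuttle distance.\<close>
  define c where "c = (1 - weight P) / weight P * mile_cost P"
  have c: "0 \<le> c"
    using weight_pos weight_le_1 mile_cost_nonneg by (simp add: c_def)
  have f1: "feasible_route P z1 r x1 y1" and f: "feasible_route P z r x y"
    using opt opt1 by (simp_all add: optimal_route_def)
  have t1: "trip_time P z1 r = route_time P r x1 y1" and t: "trip_time P z r = route_time P r x y"
    using opt opt1 by (simp_all add: trip_time_eq)
  have lex: "route_cost P r x y < route_cost P r x1 y1 \<or>
      route_cost P r x y = route_cost P r x1 y1 \<and> route_time P r x y \<le> route_time P r x1 y1"
    using opt feasible_route_mono[OF f1 le] unfolding optimal_route_def by blast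
  show ?thesis
  proof (cases "y (orig P r) (dest P r) = 1")
    case True
    \<comment> \<open>The old optimum costs no more than the direct ride, hence no more than the new
      route. This excludes the strict alternative in \<open>lex\<close>, and the tie compares the
      times.\<close>
    have "route_cost P r x1 y1 \<le> route_cost P r (\<lambda>_ _. 0) (direct_shuttle r)"
      using opt1 feasible_direct_route[OF r z1] unfolding optimal_route_def by force
    also have "\<dots> \<le> route_cost P r x y"
      by (rule direct_route_dominates(2)[OF r f True])
    finally have tt: "trip_time P z r \<le> trip_time P z1 r"
      using lex t t1 by simp
    \<comment> \<open>For a direct old route the distance difference may be negative, and the
      \<open>max\<close> in the bound is what helps; otherwise the difference is
      nonnegative.\<close>
    have "trip_time P z1 r \<le> trip_time_bound P z1 r y1"
    proof (cases "y1 (orig P r) (dest P r) = 1")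
      case False
      then have "0 \<le> c * (shuttle_distance P r y1 - min_shuttle_distance P r)"
        using c min_shuttle_distance_le_shuttle_distance[OF r f1] by simp
      then show ?thesis
        using False by (simp add: trip_time_bound_def c_def shuttle_distance_via_hubs(3)[OF r f1])
    qed (simp add: trip_time_bound_def)
    with tt show ?thesis by simp
  next
    case False
    have wc: "weight P * (c * D) = (1 - weight P) * mile_cost P * D" for D
      using weight_pos unfolding c_def by simp
    \<comment> \<open>Both alternatives in \<open>lex\<close> imply that the new cost is at most the
      old one.\<close>
    then have "weight P * (route_time P r x y + c * shuttle_distance P r y) \<le>
        weight P * (route_time P r x1 y1 + c * shuttle_distance P r y1)"
      using lex unfolding route_cost_eq distrib_left wc by linarith
    then have "route_time P r x y + c * shuttle_distance P r y \<le>
        route_time P r x1 y1 + c * shuttle_distance P r y1"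
      using weight_pos by simp
    moreover have "c * min_shuttle_distance P r \<le> c * shuttle_distance P r y"
      using c min_shuttle_distance_le_shuttle_distance[OF r f False] by (rule mult_left_mono[rotated])
    ultimately have "trip_time P z r \<le>
        trip_time P z1 r + c * (shuttle_distance P r y1 - min_shuttle_distance P r)"
      by (simp add: t t1 right_diff_distrib)
    \<comment> \<open>For a direct old route the left side is the second argument of the
      \<open>max\<close>; otherwise it equals the bound.\<close>
    also have "\<dots> \<le> trip_time_bound P z1 r y1"
      using shuttle_distance_direct[OF r f1] shuttle_distance_via_hubs(3)[OF r f1]
      by (simp add: trip_time_bound_def c_def)
    finally show ?thesis .
  qed
qed

end

section \<open>Validity of the strengthened cut\<close>

theorem proposition10:
  fixes P :: "('a, 'r) transit" and r :: 'r and z1 x1 y1 :: "'a \<Rightarrow> 'a \<Rightarrow> real"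
  assumes "transit_instance P"
    and "r \<in> trips P"
    and "is_design P z1"
    and "adopts P z1 r"
    and "optimal_route P z1 r x1 y1"
    and "trip_time_bound P z1 r y1 \<le> tolerance P r * cur_time P r"
  shows "valid_inequality P r
           (\<lambda>z \<delta>r. (\<Sum>(h, l) | h \<in> hubs P \<and> l \<in> hubs P \<and> z1 h l = 1. 1 - z h l) + \<delta>r \<ge> 1)"
proof -
  interpret transit_instance P by fact
  let ?L = "{(h, l). h \<in> hubs P \<and> l \<in> hubs P \<and> z1 h l = 1}"
  have "(\<Sum>(h, l)\<in>?L. 1 - z h l) + \<delta> r \<ge> 1" if feas: "design_feasible P z \<delta>" for z \<delta>
  proof -
    have z: "is_design P z" and \<delta>: "\<delta> r \<in> {0, 1}" "\<delta> r = 1 \<longleftrightarrow> adopts P z r"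
      using feas \<open>r \<in> trips P\<close> by (auto simp: design_feasible_def)
    have fin: "finite ?L"
      by (rule finite_subset[of _ "hubs P \<times> hubs P"]) (auto simp: finite_hubs)
    have z01: "z h l = 0 \<or> z h l = 1" if "h \<in> hubs P" "l \<in> hubs P" for h l
      using z that by (simp add: is_design_def)
    have nonneg: "0 \<le> (case p of (h, l) \<Rightarrow> 1 - z h l)" if "p \<in> ?L" for p
    proof -
      obtain h l where "p = (h, l)" by (cases p)
      then show ?thesis using z01[of h l] that by auto
    qed
    show ?thesis
    \<comment> \<open>Either a leg open under \<open>z1\<close> is closed under \<open>z\<close> and
      its term alone contributes 1, or \<open>z\<close> dominates \<open>z1\<close> on hub pairs and
      the time bound forces adoption.\<close>
    proof (cases "\<exists>h l. (h, l) \<in> ?L \<and> z h l \<noteq> 1")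
      case True
      then obtain h l where hl: "(h, l) \<in> ?L" "z h l \<noteq> 1" by blast
      then have "z h l = 0" using z01[of h l] by simp
      moreover have "(case (h, l) of (h, l) \<Rightarrow> 1 - z h l) \<le> (\<Sum>(h, l)\<in>?L. 1 - z h l)"
        using nonneg by (intro member_le_sum[OF hl(1) _ fin]) blast
      moreover have "0 \<le> \<delta> r" using \<delta>(1) by auto
      ultimately show ?thesis by simp
    next
      case False
      have "z1 h l \<le> z h l" if "h \<in> hubs P" "l \<in> hubs P" for h l
      proof -
        have "z1 h l = 0 \<or> z1 h l = 1"
          using \<open>is_design P z1\<close> that by (simp add: is_design_def)
        then show ?thesis using False z01[OF that] that by auto
      qed
      then have "trip_time P z r \<le> trip_time_bound P z1 r y1"
        by (rule trip_time_le_bound[OF assms(2,3) z _ assms(5)])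
      then have "\<delta> r = 1"
        using assms(6) \<delta>(2) by (simp add: adopts_def)
      moreover have "0 \<le> (\<Sum>(h, l)\<in>?L. 1 - z h l)"
        using nonneg by (rule sum_nonneg)
      ultimately show ?thesis by simp
    qed
  qed
  then show ?thesis by (simp add: valid_inequality_def)
qed

end
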